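(* Let $\mathbb{K}$ be a field of characteristic zero. Let $(\mathfrak{g},B,\omega)$ be a finite-dimensional quadratic symplectic Lie superalgebra of filiform type over $\mathbb{K}$ and $\delta$ the unique even invertible skew-supersymmetric superderivation of $(\mathfrak{g},B)$ such that $\omega(X,Y)=B(\delta(X),Y)$ for all $X,Y\in\mathfrak{g}$. Let $D$ be an even skew-supersymmetric superderivation of $(\mathfrak{g},B)$ and $(\widetilde{\mathfrak{g}}=\mathbb{K}e\oplus\mathfrak{g}\oplus\mathbb{K}e^*,\widetilde{B})$ the double extension of $(\mathfrak{g},B)$ by the one-dimensional Lie algebra $\mathbb{K}e$ (by means of $D$). If there exist $\alpha\in\mathbb{K}\setminus\{0\}$ and $A_0\in\mathfrak{g}_{\bar 0}$ such that $$[\delta,D]+\alpha D=\mathrm{ad}_{A_0},$$ then the linear endomorphism $\widetilde{\delta}:\widetilde{\mathfrak{g}}\to\widetilde{\mathfrak{g}}$ defined by $$\widetilde{\delta}(e^* )=\alpha e^*,\qquad \widetilde{\delta}(e)=-\alpha e+A_0,\qquad \widetilde{\delta}(X)=\delta(X)-B(X,A_0)e^*\quad\text{for all }X\in\mathfrak{g},$$ is an even invertible skew-supersymmetric superderivation of $(\widetilde{\mathfrak{g}},\widetilde{B})$. Consequently $(\widetilde{\mathfrak{g}},\widetilde{B},\widetilde{\omega})$, with $\widetilde{\omega}(X,Y)=\widetilde{B}(\widetilde{\delta}(X),Y)$ for all $X,Y\in\widetilde{\mathfrak{g}}$, is a quadratic symplectic Lie superalgebra. In this case, the quadratic symplectic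 Lie superalgebra $(\widetilde{\mathfrak{g}},\widetilde{B},\widetilde{\omega})$ is of filiform type.
   Context: A Lie superalgebra is a $\mathbb{Z}_2$-graded vector space $\mathfrak{g}=\mathfrak{g}_{\bar 0}\oplus\mathfrak{g}_{\bar 1}$ with an even bilinear bracket satisfying, for homogeneous $X,Y,Z$ of degrees $x,y,z$, $[X,Y]=-(-1)^{xy}[Y,X]$ and $(-1)^{xz}[X,[Y,Z]]+(-1)^{xy}[Y,[Z,X]]+(-1)^{yz}[Z,[X,Y]]=0$. A bilinear form $F$ is even if $F(\mathfrak{g}_{\bar 0},\mathfrak{g}_{\bar 1})=F(\mathfrak{g}_{\bar 1},\mathfrak{g}_{\bar 0})=\{0\}$. $(\mathfrak{g},B)$ is quadratic if $B$ is an even, non-degenerate, supersymmetric ($B(X,Y)=(-1)^{xy}B(Y,X)$), invariant ($B([X,Y],Z)=B(X,[Y,Z])$) bilinear form. A symplectic structure is an even, non-degenerate, skew-supersymmetric ($\omega(X,Y)=-(-1)^{xy}\omega(Y,X)$) bilinear form with $(-1)^{xz}\omega(X,[Y,Z])+(-1)^{yx}\omega(Y,[Z,X])+(-1)^{zy}\omega(Z,[X,Y])=0$. A quadratic symplectic Lie superalgebra $(\mathfrak{g},B,\omega)$ carries both. An even superderivation is a degree-preserving linear map $D$ with $D([X,Y])=[D(X),Y]+[X,D(Y)]$; it is skew-supersymmetric if $B(D(X),Y)=-B(X,D(Y))$. The symplectic structures on a quadratic $(\mathfrak{g},B)$ are exactly the forms $B(\delta(\cdot),\cdot)$ with $\delta$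 an even invertible skew-supersymmetric superderivation. Here $[\delta,D]=\delta D-D\delta$ and $\mathrm{ad}_{A_0}=[A_0,\cdot]_{\mathfrak{g}}$. Double extension by means of $D$: $\widetilde{\mathfrak{g}}=\mathbb{K}e\oplus\mathfrak{g}\oplus\mathbb{K}e^*$ with $e,e^*$ even, $[e,X]=D(X)$, $[X,Y]=[X,Y]_{\mathfrak{g}}+B(D(X),Y)e^*$ for $X,Y\in\mathfrak{g}$, $[e^*,\widetilde{\mathfrak{g}}]=\{0\}$, and $\widetilde{B}|_{\mathfrak{g}\times\mathfrak{g}}=B$, $\widetilde{B}(e^*,e)=1$, $\widetilde{B}(\mathfrak{g},e)=\widetilde{B}(\mathfrak{g},e^* )=\{0\}$, $\widetilde{B}(e,e)=\widetilde{B}(e^*,e^* )=0$. A Lie superalgebra $\mathfrak{g}$ with $\dim\mathfrak{g}_{\bar 1}=m>0$ is of filiform type if there is a flag $\mathfrak{g}_{\bar 1}=V_m\supset\dots\supset V_1\supset V_0$ with $\dim V_i=i$ and $[\mathfrak{g}_{\bar 0},V_{i+1}]=V_i$ for $0\le i\le m-1$. *)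

theory Defs
  imports Complex_Main "HOL-Library.Product_Plus" "HOL-Library.Z2"
begin

text \<open>
  The degrees of a \<open>\<int>\<^sub>2\<close>-graded space are elements of the two-element field \<open>bit\<close>, so \<open>G 0\<close> and \<open>G 1\<close>
  are the even and the odd part of \<open>G\<close>, the bracket has degree \<open>x + y\<close> on \<open>G x \<times> G y\<close>, and the sign
  attached to a pair of degrees \<open>x\<close>, \<open>y\<close> is \<open>(-1)\<^bsup>xy\<^esup>\<close>.
\<close>

abbreviation koszul_sign :: "bit \<Rightarrow> bit \<Rightarrow> 'k::field"
  where "koszul_sign x y \<equiv> (- 1) ^ of_bit (x * y)"

definition bilinear_map ::
  "('k::field \<Rightarrow> 'u::ab_group_add \<Rightarrow> 'u) \<Rightarrow> ('k \<Rightarrow> 'v::ab_group_add \<Rightarrow> 'v) \<Rightarrow>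
   ('k \<Rightarrow> 'w::ab_group_add \<Rightarrow> 'w) \<Rightarrow> ('u \<Rightarrow> 'v \<Rightarrow> 'w) \<Rightarrow> bool"
  where "bilinear_map s1 s2 s3 f \<longleftrightarrow>
    (\<forall>X. Vector_Spaces.linear s2 s3 (\<lambda>Y. f X Y)) \<and>
    (\<forall>Y. Vector_Spaces.linear s1 s3 (\<lambda>X. f X Y))"

locale super_vector_space = vector_space scale
  for scale :: "'k::field \<Rightarrow> 'v::ab_group_add \<Rightarrow> 'v" +
  fixes G :: "bit \<Rightarrow> 'v set"
  assumes subspace_G: "subspace (G x)"
    and G_direct: "G 0 \<inter> G 1 = {0}"
    and G_sum: "\<exists>X0\<in>G 0. \<exists>X1\<in>G 1. X = X0 + X1"

locale lie_superalgebra = super_vector_space scale G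
  for scale :: "'k::field \<Rightarrow> 'v::ab_group_add \<Rightarrow> 'v" and G :: "bit \<Rightarrow> 'v set" +
  fixes br :: "'v \<Rightarrow> 'v \<Rightarrow> 'v"
  assumes bilinear_br: "bilinear_map scale scale scale br"
    and even_br: "X \<in> G x \<Longrightarrow> Y \<in> G y \<Longrightarrow> br X Y \<in> G (x + y)"
    and skew_br: "X \<in> G x \<Longrightarrow> Y \<in> G y \<Longrightarrow> br X Y = - scale (koszul_sign x y) (br Y X)"
    and jacobi: "X \<in> G x \<Longrightarrow> Y \<in> G y \<Longrightarrow> Z \<in> G z \<Longrightarrow>
      scale (koszul_sign x z) (br X (br Y Z)) + scale (koszul_sign x y) (br Y (br Z X))
        + scale (koszul_sign y z) (br Z (br X Y)) = 0"

definition even_form :: "(bit \<Rightarrow> 'v set) \<Rightarrow> ('v \<Rightarrow> 'v \<Rightarrow> 'k::field) \<Rightarrow> bool"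
  where "even_form G F \<longleftrightarrow>
    (\<forall>X\<in>G 0. \<forall>Y\<in>G 1. F X Y = 0) \<and> (\<forall>X\<in>G 1. \<forall>Y\<in>G 0. F X Y = 0)"

definition nondegenerate_form :: "('v::zero \<Rightarrow> 'v \<Rightarrow> 'k::field) \<Rightarrow> bool"
  where "nondegenerate_form F \<longleftrightarrow>
    (\<forall>X. (\<forall>Y. F X Y = 0) \<longrightarrow> X = 0) \<and> (\<forall>Y. (\<forall>X. F X Y = 0) \<longrightarrow> Y = 0)"

locale quadratic_lie_superalgebra = lie_superalgebra scale G br
  for scale :: "'k::field \<Rightarrow> 'v::ab_group_add \<Rightarrow> 'v" and G :: "bit \<Rightarrow> 'v set"
    and br :: "'v \<Rightarrow> 'v \<Rightarrow> 'v" +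
  fixes B :: "'v \<Rightarrow> 'v \<Rightarrow> 'k"
  assumes bilinear_B: "bilinear_map scale scale (*) B"
    and even_B: "even_form G B"
    and nondegenerate_B: "nondegenerate_form B"
    and supersymmetric_B: "X \<in> G x \<Longrightarrow> Y \<in> G y \<Longrightarrow> B X Y = koszul_sign x y * B Y X"
    and invariant_B: "B (br X Y) Z = B X (br Y Z)"

locale symplectic_lie_superalgebra = lie_superalgebra scale G br
  for scale :: "'k::field \<Rightarrow> 'v::ab_group_add \<Rightarrow> 'v" and G :: "bit \<Rightarrow> 'v set"
    and br :: "'v \<Rightarrow> 'v \<Rightarrow> 'v" +
  fixes \<omega> :: "'v \<Rightarrow> 'v \<Rightarrow> 'k"
  assumes bilinear_omega: "bilinear_map scale scale (*) \<omega>"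
    and even_omega: "even_form G \<omega>"
    and nondegenerate_omega: "nondegenerate_form \<omega>"
    and skew_supersymmetric_omega:
      "X \<in> G x \<Longrightarrow> Y \<in> G y \<Longrightarrow> \<omega> X Y = - (koszul_sign x y * \<omega> Y X)"
    and closed_omega: "X \<in> G x \<Longrightarrow> Y \<in> G y \<Longrightarrow> Z \<in> G z \<Longrightarrow>
      koszul_sign x z * \<omega> X (br Y Z) + koszul_sign y x * \<omega> Y (br Z X)
        + koszul_sign z y * \<omega> Z (br X Y) = 0"

locale quadratic_symplectic_lie_superalgebra =
  quadratic_lie_superalgebra scale G br B + symplectic_lie_superalgebra scale G br \<omega>
  for scale :: "'k::field \<Rightarrow> 'v::ab_group_add \<Rightarrow> 'v" and G :: "bit \<Rightarrow> 'v set"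
    and br :: "'v \<Rightarrow> 'v \<Rightarrow> 'v" and B :: "'v \<Rightarrow> 'v \<Rightarrow> 'k" and \<omega> :: "'v \<Rightarrow> 'v \<Rightarrow> 'k"

text \<open>
  As usual, a bracket of two subspaces is the span of the brackets of their elements. Since
  \<open>dim\<close> is \<open>0\<close> on infinite-dimensional spaces, \<open>dim (G 1) > 0\<close> includes that the odd part is
  finite-dimensional.
\<close>

locale filiform_lie_superalgebra = lie_superalgebra scale G br
  for scale :: "'k::field \<Rightarrow> 'v::ab_group_add \<Rightarrow> 'v" and G :: "bit \<Rightarrow> 'v set"
    and br :: "'v \<Rightarrow> 'v \<Rightarrow> 'v" +
  assumes odd_dim_pos: "dim (G 1) > 0"
    and filiform_flag: "\<exists>V :: nat \<Rightarrow> 'v set.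
      V (dim (G 1)) = G 1 \<and>
      (\<forall>i\<le>dim (G 1). subspace (V i) \<and> dim (V i) = i) \<and>
      (\<forall>i<dim (G 1). V i \<subset> V (Suc i)) \<and>
      (\<forall>i<dim (G 1). span {br X Y |X Y. X \<in> G 0 \<and> Y \<in> V (Suc i)} = V i)"

definition even_superderivation ::
  "('k::field \<Rightarrow> 'v::ab_group_add \<Rightarrow> 'v) \<Rightarrow> (bit \<Rightarrow> 'v set) \<Rightarrow> ('v \<Rightarrow> 'v \<Rightarrow> 'v) \<Rightarrow> ('v \<Rightarrow> 'v) \<Rightarrow> bool"
  where "even_superderivation scale G br D \<longleftrightarrow>
    Vector_Spaces.linear scale scale D \<and>
    (\<forall>x. \<forall>X\<in>G x. D X \<in> G x) \<and>
    (\<forall>X Y. D (br X Y) = br (D X) Y + br X (D Y))"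

definition skew_supersymmetric_endo :: "('v \<Rightarrow> 'v \<Rightarrow> 'k::field) \<Rightarrow> ('v \<Rightarrow> 'v) \<Rightarrow> bool"
  where "skew_supersymmetric_endo B D \<longleftrightarrow> (\<forall>X Y. B (D X) Y = - B X (D Y))"


text \<open>
  The triple \<open>(a, X, c)\<close> stands for the element \<open>a e + X + c e\<^sup>*\<close> of the double extension.
\<close>

type_synonym ('k, 'v) dext = "'k \<times> 'v \<times> 'k"

abbreviation dext_e :: "('k::field, 'v::ab_group_add) dext" where "dext_e \<equiv> (1, 0, 0)"
abbreviation dext_estar :: "('k::field, 'v::ab_group_add) dext" where "dext_estar \<equiv> (0, 0, 1)"
abbreviation dext_emb :: "'v \<Rightarrow> ('k::field, 'v::ab_group_add) dext" where "dext_emb X \<equiv> (0, X, 0)"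

definition dext_scale ::
  "('k::field \<Rightarrow> 'v::ab_group_add \<Rightarrow> 'v) \<Rightarrow> 'k \<Rightarrow> ('k, 'v) dext \<Rightarrow> ('k, 'v) dext"
  where "dext_scale scale r = (\<lambda>(a, X, c). (r * a, scale r X, r * c))"

definition dext_grading :: "(bit \<Rightarrow> 'v::ab_group_add set) \<Rightarrow> bit \<Rightarrow> ('k::field, 'v) dext set"
  where "dext_grading G x = (if x = 0 then UNIV \<times> G 0 \<times> UNIV else {0} \<times> G 1 \<times> {0})"

definition dext_bracket ::
  "('k::field \<Rightarrow> 'v::ab_group_add \<Rightarrow> 'v) \<Rightarrow> ('v \<Rightarrow> 'v \<Rightarrow> 'v) \<Rightarrow> ('v \<Rightarrow> 'v \<Rightarrow> 'k) \<Rightarrow> ('v \<Rightarrow> 'v) \<Rightarrow>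
   ('k, 'v) dext \<Rightarrow> ('k, 'v) dext \<Rightarrow> ('k, 'v) dext"
  where "dext_bracket scale br B D = (\<lambda>(a, X, c) (a', X', c').
    (0, scale a (D X') - scale a' (D X) + br X X', B (D X) X'))"

definition dext_form ::
  "('v \<Rightarrow> 'v \<Rightarrow> 'k::field) \<Rightarrow> ('k, 'v) dext \<Rightarrow> ('k, 'v) dext \<Rightarrow> 'k"
  where "dext_form B = (\<lambda>(a, X, c) (a', X', c'). B X X' + c * a' + a * c')"

definition dext_endo ::
  "('k::field \<Rightarrow> 'v::ab_group_add \<Rightarrow> 'v) \<Rightarrow> ('v \<Rightarrow> 'v \<Rightarrow> 'k) \<Rightarrow> ('v \<Rightarrow> 'v) \<Rightarrow> 'k \<Rightarrow> 'v \<Rightarrow>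
   ('k, 'v) dext \<Rightarrow> ('k, 'v) dext"
  where "dext_endo scale B \<delta> \<alpha> A0 = (\<lambda>(a, X, c).
    (- \<alpha> * a, \<delta> X + scale a A0, \<alpha> * c - B X A0))"

text \<open>
  The formulas above are the (bi)linear extensions of the values on \<open>e\<close>, \<open>\<gg>\<close> and \<open>e\<^sup>*\<close> by which the
  double extension and the endomorphism are usually described.
\<close>

context
  fixes scale :: "'k::field \<Rightarrow> 'v::ab_group_add \<Rightarrow> 'v" and br :: "'v \<Rightarrow> 'v \<Rightarrow> 'v"
    and B :: "'v \<Rightarrow> 'v \<Rightarrow> 'k" and D \<delta> :: "'v \<Rightarrow> 'v"
  assumes vs: "vector_space scale"
    and br: "bilinear_map scale scale scale br"
    and B: "bilinear_map scale scale (*) B"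
    and D: "Vector_Spaces.linear scale scale D"
    and \<delta>: "Vector_Spaces.linear scale scale \<delta>"
begin

interpretation vector_space scale by (rule vs)

private lemma zeros: "br 0 X = 0" "br X 0 = 0" "B 0 X = 0" "B X 0 = 0" "D 0 = 0" "\<delta> 0 = 0"
  using br B D \<delta> unfolding bilinear_map_def Vector_Spaces.linear_iff_module_hom
  by (auto dest!: module_hom.zero spec)

lemma dext_decompose:
  "(a, X, c) = dext_scale scale a dext_e + dext_emb X + dext_scale scale c dext_estar"
  by (simp add: dext_scale_def)

lemma dext_bracket_generators:
  "dext_bracket scale br B D dext_e (dext_emb X) = dext_emb (D X)"
  "dext_bracket scale br B D (dext_emb X) dext_e = - dext_emb (D X)"
  "dext_bracket scale br B D (dext_emb X) (dext_emb Y) =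
     dext_emb (br X Y) + dext_scale scale (B (D X) Y) dext_estar"
  "dext_bracket scale br B D dext_e dext_e = 0"
  "dext_bracket scale br B D dext_estar u = 0"
  "dext_bracket scale br B D u dext_estar = 0"
  by (auto simp: dext_bracket_def dext_scale_def zeros zero_prod_def split: prod.split)

lemma dext_form_generators:
  "dext_form B (dext_emb X) (dext_emb Y) = B X Y"
  "dext_form B dext_estar dext_e = 1" "dext_form B dext_e dext_estar = 1"
  "dext_form B (dext_emb X) dext_e = 0" "dext_form B dext_e (dext_emb X) = 0"
  "dext_form B (dext_emb X) dext_estar = 0" "dext_form B dext_estar (dext_emb X) = 0"
  "dext_form B dext_e dext_e = 0" "dext_form B dext_estar dext_estar = 0"
  by (auto simp: dext_form_def zeros)

lemma dext_endo_generators: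
  "dext_endo scale B \<delta> \<alpha> A0 dext_estar = dext_scale scale \<alpha> dext_estar"
  "dext_endo scale B \<delta> \<alpha> A0 dext_e = - dext_scale scale \<alpha> dext_e + dext_emb A0"
  "dext_endo scale B \<delta> \<alpha> A0 (dext_emb X) =
     dext_emb (\<delta> X) - dext_scale scale (B X A0) dext_estar"
  by (auto simp: dext_endo_def dext_scale_def zeros)

end

end

theory Submission
  imports Defs
begin

text \<open>
  The identities for the double extension and for the extended endomorphism are checked
  componentwise; the \<open>e\<^sup>*\<close>-component of the Jacobi identity is the closedness of the form \<open>B(D X, Y)\<close>,
  which is the same computation as the one that turns a skew superderivation into a symplectic form.

  For the filiform type, \<open>e\<close> acts on the odd part as \<open>D\<close>, so the flag of \<open>\<gg>\<close> still works if
  \<open>D V\<^bsub>i+1\<^esub> \<subseteq> V\<^bsub>i\<^esub>\<close>. The flag consists of iterated brackets with the even part, hence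
  is stable under superderivations, and on its one-dimensional quotients the relation
  \<open>[\<delta>, D] + \<alpha> D = ad A0\<close> reduces to \<open>\<alpha> D = 0\<close>.
\<close>

lemma bit_cases: "(x::bit) = 0 \<or> x = 1"
  by (cases x) simp_all

section \<open>Bilinearity of the bracket and stability of filiform flags under
  superderivations\<close>

context lie_superalgebra
begin

lemma br_linear [simp]:
  "br (X + Y) Z = br X Z + br Y Z" "br X (Y + Z) = br X Y + br X Z"
  "br (X - Y) Z = br X Z - br Y Z" "br X (Y - Z) = br X Y - br X Z"
  "br (- X) Y = - br X Y" "br X (- Y) = - br X Y"
  "br (scale k X) Y = scale k (br X Y)" "br X (scale k Y) = scale k (br X Y)"
  "br 0 Y = 0" "br X 0 = 0"
proof -
  interpret l: module_hom scale scale "\<lambda>X. br X Y" for Y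
    using bilinear_br by (simp add: bilinear_map_def Vector_Spaces.linear_iff_module_hom)
  interpret r: module_hom scale scale "br X" for X
    using bilinear_br by (simp add: bilinear_map_def Vector_Spaces.linear_iff_module_hom)
  show "br (X + Y) Z = br X Z + br Y Z" "br X (Y + Z) = br X Y + br X Z"
    "br (X - Y) Z = br X Z - br Y Z" "br X (Y - Z) = br X Y - br X Z"
    "br (- X) Y = - br X Y" "br X (- Y) = - br X Y"
    "br (scale k X) Y = scale k (br X Y)" "br X (scale k Y) = scale k (br X Y)"
    "br 0 Y = 0" "br X 0 = 0"
    by (rule l.add r.add l.diff r.diff l.neg r.neg l.scale r.scale l.zero r.zero)+
qed

text \<open>Descending induction from \<open>V m = G 1\<close>, which is stable because
  \<open>d\<close> preserves degrees. One level down, the Leibniz rule sends a generator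
  \<open>br P Q\<close> to \<open>br (d P) Q + br P (d Q)\<close>; here \<open>d P\<close> is still
  even and \<open>d Q\<close> stays in \<open>V (Suc n)\<close>, so both terms are again
  generators.\<close>

lemma superderivation_flag_invariant:
  fixes V :: "nat \<Rightarrow> 'v set"
  assumes d: "even_superderivation scale G br d"
    and top: "V m = G 1"
    and step: "\<forall>i<m. span {br X Y |X Y. X \<in> G 0 \<and> Y \<in> V (Suc i)} = V i"
    and "i \<le> m" and "X \<in> V i"
  shows "d X \<in> V i"
  using \<open>i \<le> m\<close> \<open>X \<in> V i\<close>
proof (induction i arbitrary: X rule: inc_induct)
  case base
  then show ?case using d top by (auto simp: even_superderivation_def)
next
  case (step n)
  let ?S = "{br X Y |X Y. X \<in> G 0 \<and> Y \<in> V (Suc n)}"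
  have V: "V n = span ?S" using assms(3) step.hyps by simp
  interpret d: module_hom scale scale d
    using d by (simp add: even_superderivation_def Vector_Spaces.linear_iff_module_hom)
  have "d Y \<in> span ?S" if Y: "Y \<in> ?S" for Y
  proof -
    obtain P Q where PQ: "Y = br P Q" "P \<in> G 0" "Q \<in> V (Suc n)" using Y by blast
    moreover have "d P \<in> G 0"
      using d PQ by (simp add: even_superderivation_def)
    ultimately have "br (d P) Q \<in> ?S" "br P (d Q) \<in> ?S"
      using step.IH by blast+
    moreover have "d Y = br (d P) Q + br P (d Q)"
      using d PQ by (simp add: even_superderivation_def)
    ultimately show ?thesis by (simp add: span_add span_base)
  qed
  then have "d ` span ?S \<subseteq> span ?S"
    unfolding d.span_image[symmetric] by (intro span_minimal) auto
  with step.prems V show ?case by auto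
qed

end

section \<open>Invariant forms and the symplectic forms given by skew superderivations\<close>

context quadratic_lie_superalgebra
begin

lemma B_linear [simp]:
  "B (X + Y) Z = B X Z + B Y Z" "B X (Y + Z) = B X Y + B X Z"
  "B (X - Y) Z = B X Z - B Y Z" "B X (Y - Z) = B X Y - B X Z"
  "B (- X) Y = - B X Y" "B X (- Y) = - B X Y"
  "B (scale k X) Y = k * B X Y" "B X (scale k Y) = k * B X Y"
  "B 0 Y = 0" "B X 0 = 0"
proof -
  interpret l: module_hom scale "(*)" "\<lambda>X. B X Y" for Y
    using bilinear_B by (simp add: bilinear_map_def Vector_Spaces.linear_iff_module_hom)
  interpret r: module_hom scale "(*)" "B X" for X
    using bilinear_B by (simp add: bilinear_map_def Vector_Spaces.linear_iff_module_hom)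
  show "B (X + Y) Z = B X Z + B Y Z" "B X (Y + Z) = B X Y + B X Z"
    "B (X - Y) Z = B X Z - B Y Z" "B X (Y - Z) = B X Y - B X Z"
    "B (- X) Y = - B X Y" "B X (- Y) = - B X Y"
    "B (scale k X) Y = k * B X Y" "B X (scale k Y) = k * B X Y"
    "B 0 Y = 0" "B X 0 = 0"
    by (rule l.add r.add l.diff r.diff l.neg r.neg l.scale r.scale l.zero r.zero)+
qed

lemma B_even_odd: "X \<in> G 0 \<Longrightarrow> Y \<in> G 1 \<Longrightarrow> B X Y = 0" "X \<in> G 1 \<Longrightarrow> Y \<in> G 0 \<Longrightarrow> B X Y = 0"
  using even_B by (auto simp: even_form_def)

text \<open>The odd component of \<open>Y\<close> is orthogonal to \<open>X\<close>, and on the even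
  component the supersymmetry sign is 1. This lets \<open>A0\<close> change sides against
  inhomogeneous arguments.\<close>

lemma B_commute_even:
  assumes "X \<in> G 0"
  shows "B X Y = B Y X"
proof -
  obtain Y0 Y1 where "Y0 \<in> G 0" "Y1 \<in> G 1" "Y = Y0 + Y1"
    using G_sum by blast
  then show ?thesis
    using assms supersymmetric_B[of X 0 Y0 0] by (simp add: B_even_odd)
qed

text \<open>Skewness moves \<open>d\<close> to the bracket, Leibniz splits it, and invariance with
  supersymmetry turns the two resulting terms into the other two of the cyclic sum. It serves twice:
  for \<open>D\<close>, in the Jacobi identity of the double extension, and for the extended
  endomorphism, in the closedness of the new symplectic form.\<close>

lemma superderivation_form_closed:
  assumes d: "even_superderivation scale G br d" and skew: "skew_supersymmetric_endo B d"
    and X: "X \<in> G x" and Y: "Y \<in> G y" and Z: "Z \<in> G z"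
  shows "koszul_sign x z * B (d X) (br Y Z) + koszul_sign y x * B (d Y) (br Z X)
    + koszul_sign z y * B (d Z) (br X Y) = 0"
proof -
  have dG: "d X \<in> G x" "d Y \<in> G y" "d Z \<in> G z"
    using d X Y Z by (auto simp: even_superderivation_def)
  have "B (d X) (br Y Z) = - B (br X (d Y)) Z - B (br X Y) (d Z)"
    using d skew by (simp add: even_superderivation_def skew_supersymmetric_endo_def invariant_B)
  also have "B (br X (d Y)) Z = - (koszul_sign x y * B (d Y) (br X Z))"
    using skew_br[OF X dG(2)] by (simp add: invariant_B)
  also have "br X Z = - scale (koszul_sign x z) (br Z X)"
    by (rule skew_br[OF X Z])
  also have "B (br X Y) (d Z) = koszul_sign (x + y) z * B (d Z) (br X Y)"
    by (rule supersymmetric_B[OF even_br[OF X Y] dG(3)])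
  finally show ?thesis
    using bit_cases[of x] bit_cases[of y] bit_cases[of z] by auto
qed

lemma symplectic_superderivation_form:
  assumes d: "even_superderivation scale G br d" and skew: "skew_supersymmetric_endo B d"
    and "bij d"
  shows "symplectic_lie_superalgebra scale G br (\<lambda>X Y. B (d X) Y)"
proof unfold_locales
  have lin: "Vector_Spaces.linear scale scale d" and even: "\<And>x X. X \<in> G x \<Longrightarrow> d X \<in> G x"
    using d by (auto simp: even_superderivation_def)
  have d0: "d 0 = 0"
    using lin by (simp add: Vector_Spaces.linear_iff_module_hom module_hom.zero)
  show "bilinear_map scale scale (*) (\<lambda>X Y. B (d X) Y)"
    using bilinear_B Vector_Spaces.linear_compose[OF lin]
    by (auto simp: bilinear_map_def o_def)
  show "even_form G (\<lambda>X Y. B (d X) Y)"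
    using even by (auto simp: even_form_def B_even_odd)
  \<comment> \<open>Injectivity of \<open>d\<close> kills the left radical; the right radical below
    uses surjectivity.\<close>
  have "X = 0" if "\<forall>Y. B (d X) Y = 0" for X
    using that nondegenerate_B d0 \<open>bij d\<close>
    by (metis nondegenerate_form_def bij_is_inj injD)
  moreover have "Y = 0" if "\<forall>X. B (d X) Y = 0" for Y
    using that nondegenerate_B \<open>bij d\<close> by (metis nondegenerate_form_def bij_pointE)
  ultimately show "nondegenerate_form (\<lambda>X Y. B (d X) Y)"
    by (auto simp: nondegenerate_form_def)
  show "B (d X) Y = - (koszul_sign x y * B (d Y) X)" if "X \<in> G x" "Y \<in> G y" for X x Y y
    using that skew even supersymmetric_B[of X x "d Y" y]
    by (simp add: skew_supersymmetric_endo_def)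
qed (rule superderivation_form_closed[OF d skew])

end

section \<open>The double extension as a quadratic Lie superalgebra\<close>

locale quadratic_double_extension = quadratic_lie_superalgebra scale G br B
  for scale :: "'k::field \<Rightarrow> 'v::ab_group_add \<Rightarrow> 'v" and G :: "bit \<Rightarrow> 'v set"
    and br :: "'v \<Rightarrow> 'v \<Rightarrow> 'v" and B :: "'v \<Rightarrow> 'v \<Rightarrow> 'k" +
  fixes D :: "'v \<Rightarrow> 'v"
  assumes D_superderivation: "even_superderivation scale G br D"
    and D_skew: "skew_supersymmetric_endo B D"
begin

lemma D_linear: "Vector_Spaces.linear scale scale D"
  and D_even: "X \<in> G x \<Longrightarrow> D X \<in> G x"
  and D_br: "D (br X Y) = br (D X) Y + br X (D Y)"
  using D_superderivation by (auto simp: even_superderivation_def)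

lemma D_simps [simp]:
  "D (X + Y) = D X + D Y" "D (X - Y) = D X - D Y" "D (- X) = - D X"
  "D (scale k X) = scale k (D X)" "D 0 = 0"
  using D_linear unfolding Vector_Spaces.linear_iff_module_hom
  by (simp_all add: module_hom.add module_hom.diff module_hom.neg module_hom.scale module_hom.zero)

lemma B_D: "B (D X) Y = - B X (D Y)"
  using D_skew by (simp add: skew_supersymmetric_endo_def)

abbreviation "ext_scale \<equiv> dext_scale scale"
abbreviation "ext_G \<equiv> dext_grading G :: bit \<Rightarrow> ('k, 'v) dext set"
abbreviation "ext_br \<equiv> dext_bracket scale br B D"
abbreviation "ext_B \<equiv> dext_form B"

lemma vector_space_ext: "vector_space ext_scale"
  by unfold_locales
    (auto simp: dext_scale_def scale_right_distrib scale_left_distrib algebra_simps)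

lemma linear_ext_iff:
  assumes "vector_space s"
  shows "Vector_Spaces.linear ext_scale s f \<longleftrightarrow>
    (\<forall>u v. f (u + v) = f u + f v) \<and> (\<forall>k u. f (ext_scale k u) = s k (f u))"
  using vector_space_ext assms by (simp add: Vector_Spaces.linear_iff)

lemma super_vector_space_ext: "super_vector_space ext_scale ext_G"
proof -
  interpret E: vector_space ext_scale
    by (rule vector_space_ext)
  have G0: "0 \<in> G x" for x
    using subspace_G subspace_0 by blast
  show ?thesis
  proof unfold_locales
    show "E.subspace (ext_G x)" for x
      using subspace_G[of 0] subspace_G[of 1]
      by (auto simp: E.subspace_def subspace_def dext_grading_def dext_scale_def zero_prod_def)
    show "ext_G 0 \<inter> ext_G 1 = {0}"
      using G_direct by (auto simp: dext_grading_def zero_prod_def)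
    show "\<exists>u0\<in>ext_G 0. \<exists>u1\<in>ext_G 1. u = u0 + u1" for u
    proof -
      obtain a X c X0 X1 where "u = (a, X, c)" "X0 \<in> G 0" "X1 \<in> G 1" "X = X0 + X1"
        using G_sum by (metis prod_cases3)
      then have "(a, X0, c) \<in> ext_G 0" "(0, X1, 0) \<in> ext_G 1" "u = (a, X0, c) + (0, X1, 0)"
        by (auto simp: dext_grading_def)
      then show ?thesis by blast
    qed
  qed
qed

lemma ext_G_cases:
  assumes "u \<in> ext_G x"
  obtains a X c where "u = (a, X, c)" "X \<in> G x" "x = 1 \<Longrightarrow> a = 0" "x = 1 \<Longrightarrow> c = 0"
  using assms bit_cases[of x] that by (auto simp: dext_grading_def)

lemma ext_G_iff:
  "(a, X, c) \<in> ext_G x \<longleftrightarrow> X \<in> G x \<and> (x = 1 \<longrightarrow> a = 0 \<and> c = 0)"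
  using bit_cases[of x] by (auto simp: dext_grading_def)

lemma lie_superalgebra_ext: "lie_superalgebra ext_scale ext_G ext_br"
proof -
  interpret E: super_vector_space ext_scale ext_G
    by (rule super_vector_space_ext)
  show ?thesis
  proof unfold_locales
    show "bilinear_map ext_scale ext_scale ext_scale ext_br"
      unfolding bilinear_map_def linear_ext_iff[OF vector_space_ext]
      by (auto simp: dext_bracket_def dext_scale_def scale_left_distrib scale_right_distrib
          scale_right_diff_distrib scale_left_diff_distrib algebra_simps)
  next
    fix u v :: "('k, 'v) dext" and x y
    assume u: "u \<in> ext_G x" and v: "v \<in> ext_G y"
    obtain a X c b Y d where uv: "u = (a, X, c)" "v = (b, Y, d)" "X \<in> G x" "Y \<in> G y"
      "x = 1 \<Longrightarrow> a = 0" "y = 1 \<Longrightarrow> b = 0"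
      using ext_G_cases[OF u] ext_G_cases[OF v] by metis
    have sub: "subspace (G x)" for x by (rule subspace_G)
    \<comment> \<open>Since \<open>e*\<close> is even, the \<open>e*\<close>-component of a bracket
      of odd degree has to vanish.\<close>
    have odd: "B (D X) Y = 0" if "x + y = 1"
      using that uv bit_cases[of x] bit_cases[of y] by (auto simp: B_even_odd D_even)
    have "scale a (D Y) \<in> G (x + y)"
      using uv bit_cases[of x] bit_cases[of y]
      by (elim disjE) (simp_all add: subspace_0[OF sub] subspace_scale[OF sub] D_even)
    moreover have "scale b (D X) \<in> G (x + y)"
      using uv bit_cases[of x] bit_cases[of y]
      by (elim disjE) (simp_all add: subspace_0[OF sub] subspace_scale[OF sub] D_even)
    ultimately show "ext_br u v \<in> ext_G (x + y)"
      using even_br[OF uv(3,4)] odd unfolding uv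
      by (auto simp: ext_G_iff dext_bracket_def intro!: subspace_add[OF sub] subspace_diff[OF sub])
    have "B (D X) Y = - (koszul_sign x y * B (D Y) X)"
      using supersymmetric_B[OF uv(3) D_even[OF uv(4)]] by (simp add: B_D)
    moreover have "br X Y = - scale (koszul_sign x y) (br Y X)"
      by (rule skew_br[OF uv(3,4)])
    ultimately show "ext_br u v = - ext_scale (koszul_sign x y) (ext_br v u)"
      using uv bit_cases[of x] bit_cases[of y]
      by (auto simp: dext_bracket_def dext_scale_def)
  next
    fix u v w :: "('k, 'v) dext" and x y z
    assume u: "u \<in> ext_G x" and v: "v \<in> ext_G y" and w: "w \<in> ext_G z"
    obtain a X a' b Y b' c Z c' where uvw: "u = (a, X, a')" "v = (b, Y, b')" "w = (c, Z, c')"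
      "X \<in> G x" "Y \<in> G y" "Z \<in> G z" "x = 1 \<Longrightarrow> a = 0" "y = 1 \<Longrightarrow> b = 0" "z = 1 \<Longrightarrow> c = 0"
      using ext_G_cases[OF u] ext_G_cases[OF v] ext_G_cases[OF w] by metis
    have deg: "x = 0 \<or> x = 1 \<and> a = 0" "y = 0 \<or> y = 1 \<and> b = 0" "z = 0 \<or> z = 1 \<and> c = 0"
      using bit_cases uvw(7-9) by blast+
    \<comment> \<open>A degree can be odd only if the coefficient of \<open>e\<close> vanishes, so every sign is absorbed by the
      coefficient it multiplies, and the Jacobi sum splits into multiples of identities on \<open>\<gg>\<close>.\<close>
    define s1 :: 'k where "s1 = koszul_sign x z"
    define s2 :: 'k where "s2 = koszul_sign x y"
    define s3 :: 'k where "s3 = koszul_sign y z"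
    have signs: "s1 * a = a" "s2 * a = a" "s2 * b = b" "s3 * b = b" "s1 * c = c" "s3 * c = c"
      using deg by (auto simp: s1_def s2_def s3_def)
    have signs': "a * s1 = a" "a * s2 = a" "b * s2 = b" "b * s3 = b" "c * s1 = c" "c * s3 = c"
      "a * (b * s1) = a * b" "b * (c * s2) = b * c"
      using signs by auto
    have mul: "a * (s1 * r) = a * r" "a * (s2 * r) = a * r" "b * (s2 * r) = b * r"
      "b * (s3 * r) = b * r" "b * (s1 * (s3 * r)) = b * (s1 * r)" "c * (s1 * r) = c * r"
      "c * (s3 * r) = c * r" for r
      using signs by auto
    \<comment> \<open>\<open>v1\<close>, \<open>v2\<close>, \<open>v3\<close> are the contributions
      of \<open>e\<close> to the middle components of the three inner brackets, separated from the
      brackets of the original algebra.\<close>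
    define v1 where "v1 = scale b (D Z) - scale c (D Y)"
    define v2 where "v2 = scale c (D X) - scale a (D Z)"
    define v3 where "v3 = scale a (D Y) - scale b (D X)"
    have L: "br (D Y) Z + scale s3 (br Z (D Y)) = 0" "br (D Z) X + scale s1 (br X (D Z)) = 0"
      "br (D X) Y + scale s2 (br Y (D X)) = 0"
      using skew_br[OF D_even[OF uvw(5)] uvw(6)] skew_br[OF D_even[OF uvw(6)] uvw(4)]
        skew_br[OF D_even[OF uvw(4)] uvw(5)]
      by (simp_all add: s1_def s2_def s3_def mult.commute)
    \<comment> \<open>The terms with \<open>D\<close> applied twice cancel in pairs. Of the two
      Leibniz terms with coefficient \<open>a\<close>, one cancels against a bracket with
      \<open>v2\<close> and the other joins a bracket with \<open>v3\<close> to form an expression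
      from \<open>L\<close>; likewise for \<open>b\<close> and \<open>c\<close>.\<close>
    have "scale s1 (scale a (D (v1 + br Y Z)) + br X v1) + scale s2 (scale b (D (v2 + br Z X)) + br Y v2)
        + scale s3 (scale c (D (v3 + br X Y)) + br Z v3)
      = scale a (br (D Y) Z + scale s3 (br Z (D Y))) + scale b (br (D Z) X + scale s1 (br X (D Z)))
        + scale c (br (D X) Y + scale s2 (br Y (D X)))"
      unfolding v1_def v2_def v3_def
      by (simp add: D_br scale_right_distrib scale_right_diff_distrib signs' algebra_simps)
    also have "\<dots> = 0"
      by (simp only: L scale_zero_right add_0)
    finally have D_part: "scale s1 (scale a (D (v1 + br Y Z)) + br X v1)
        + scale s2 (scale b (D (v2 + br Z X)) + br Y v2)
        + scale s3 (scale c (D (v3 + br X Y)) + br Z v3) = 0" .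
    have br_part: "scale s1 (br X (br Y Z)) + scale s2 (br Y (br Z X)) + scale s3 (br Z (br X Y)) = 0"
      unfolding s1_def s2_def s3_def by (rule jacobi[OF uvw(4-6)])
    have "scale s1 (scale a (D (v1 + br Y Z)) + br X (v1 + br Y Z))
        + scale s2 (scale b (D (v2 + br Z X)) + br Y (v2 + br Z X))
        + scale s3 (scale c (D (v3 + br X Y)) + br Z (v3 + br X Y))
      = (scale s1 (scale a (D (v1 + br Y Z)) + br X v1)
        + scale s2 (scale b (D (v2 + br Z X)) + br Y v2)
        + scale s3 (scale c (D (v3 + br X Y)) + br Z v3))
        + (scale s1 (br X (br Y Z)) + scale s2 (br Y (br Z X)) + scale s3 (br Z (br X Y)))"
      by (simp add: scale_right_distrib ac_simps)
    also have "\<dots> = 0"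
      by (simp only: D_part br_part add_0)
    finally have M: "scale s1 (scale a (D (v1 + br Y Z)) + br X (v1 + br Y Z))
        + scale s2 (scale b (D (v2 + br Z X)) + br Y (v2 + br Z X))
        + scale s3 (scale c (D (v3 + br X Y)) + br Z (v3 + br X Y)) = 0" .
    have S: "B (D Y) (D Z) = s3 * B (D Z) (D Y)" "B (D Z) (D X) = s1 * B (D X) (D Z)"
      "B (D X) (D Y) = s2 * B (D Y) (D X)"
      using supersymmetric_B[OF D_even[OF uvw(5)] D_even[OF uvw(6)]]
        supersymmetric_B[OF D_even[OF uvw(6)] D_even[OF uvw(4)]]
        supersymmetric_B[OF D_even[OF uvw(4)] D_even[OF uvw(5)]]
      by (simp_all add: s1_def s2_def s3_def mult.commute)
    have C: "s1 * B (D X) (br Y Z) + s2 * B (D Y) (br Z X) + s3 * B (D Z) (br X Y) = 0"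
      using superderivation_form_closed[OF D_superderivation D_skew uvw(4-6)]
      by (simp only: s1_def s2_def s3_def mult.commute[of y x] mult.commute[of z y])
    \<comment> \<open>This is the \<open>e*\<close>-component: the terms from \<open>v1\<close>,
      \<open>v2\<close>, \<open>v3\<close> cancel in pairs by supersymmetry, which leaves
      \<open>C\<close>.\<close>
    have E: "s1 * B (D X) (v1 + br Y Z) + s2 * B (D Y) (v2 + br Z X) + s3 * B (D Z) (v3 + br X Y) = 0"
      using C unfolding v1_def v2_def v3_def by (simp add: S mul algebra_simps)
    have br2: "ext_br v w = (0, v1 + br Y Z, B (D Y) Z)" "ext_br w u = (0, v2 + br Z X, B (D Z) X)"
      "ext_br u v = (0, v3 + br X Y, B (D X) Y)"
      by (simp_all add: uvw(1-3) v1_def v2_def v3_def dext_bracket_def)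
    \<comment> \<open>The inner brackets have no \<open>e\<close>-component, so only this case of
      the outer bracket occurs.\<close>
    have br3: "ext_br (k, P, r) (0, Q, t) = (0, scale k (D Q) + br P Q, B (D P) Q)" for k P r Q t
      by (simp add: dext_bracket_def)
    show "ext_scale (koszul_sign x z) (ext_br u (ext_br v w))
      + ext_scale (koszul_sign x y) (ext_br v (ext_br w u))
      + ext_scale (koszul_sign y z) (ext_br w (ext_br u v)) = 0"
      unfolding br2 unfolding uvw(1-3) br3 dext_scale_def zero_prod_def
      using M E by (simp only: s1_def s2_def s3_def case_prod_conv add_Pair mult_zero_right add_0)
  qed
qed

lemma quadratic_lie_superalgebra_ext: "quadratic_lie_superalgebra ext_scale ext_G ext_br ext_B"
proof -
  interpret E: lie_superalgebra ext_scale ext_G ext_br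
    by (rule lie_superalgebra_ext)
  have "vector_space ((*) :: 'k \<Rightarrow> 'k \<Rightarrow> 'k)"
    by unfold_locales (auto simp: algebra_simps)
  note lin = linear_ext_iff[OF this]
  show ?thesis
  proof unfold_locales
    show "bilinear_map ext_scale ext_scale (*) ext_B"
      unfolding bilinear_map_def lin
      by (auto simp: dext_form_def dext_scale_def algebra_simps)
    show "even_form ext_G ext_B"
      by (auto simp: even_form_def dext_form_def dext_grading_def B_even_odd)
    \<comment> \<open>Pairing with \<open>e*\<close> reads off the coefficient of \<open>e\<close>,
      pairing with \<open>e\<close> that of \<open>e*\<close>, and the embedded vectors reduce the
      rest to nondegeneracy of \<open>B\<close>.\<close>
    have "u = 0" if "\<forall>v. ext_B u v = 0" for u
    proof -
      obtain a X c where u: "u = (a, X, c)" by (metis prod_cases3)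
      have "a = 0" "c = 0" "\<And>Y. B X Y = 0"
        using that[rule_format, of "dext_estar"] that[rule_format, of "dext_e"]
          that[rule_format, of "dext_emb _"] by (auto simp: u dext_form_def)
      then show ?thesis
        using nondegenerate_B by (auto simp: u nondegenerate_form_def zero_prod_def)
    qed
    moreover have "v = 0" if "\<forall>u. ext_B u v = 0" for v
    proof -
      obtain a X c where v: "v = (a, X, c)" by (metis prod_cases3)
      have "a = 0" "c = 0" "\<And>Y. B Y X = 0"
        using that[rule_format, of "dext_estar"] that[rule_format, of "dext_e"]
          that[rule_format, of "dext_emb _"] by (auto simp: v dext_form_def)
      then show ?thesis
        using nondegenerate_B by (auto simp: v nondegenerate_form_def zero_prod_def)
    qed
    ultimately show "nondegenerate_form ext_B"
      by (simp add: nondegenerate_form_def)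
  next
    fix u v :: "('k, 'v) dext" and x y
    assume u: "u \<in> ext_G x" and v: "v \<in> ext_G y"
    then show "ext_B u v = koszul_sign x y * ext_B v u"
      using bit_cases[of x] bit_cases[of y] supersymmetric_B[of "fst (snd u)" x "fst (snd v)" y]
      by (auto simp: dext_form_def ext_G_iff algebra_simps split: prod.splits)
  next
    fix u v w :: "('k, 'v) dext"
    obtain a X a' b Y b' c Z c' where uvw: "u = (a, X, a')" "v = (b, Y, b')" "w = (c, Z, c')"
      by (metis prod_cases3)
    show "ext_B (ext_br u v) w = ext_B u (ext_br v w)"
      by (simp add: uvw dext_form_def dext_bracket_def invariant_B B_D algebra_simps)
  qed
qed

end

text \<open>All results on quadratic Lie superalgebras now apply to the extension itself; in
  particular \<open>E.symplectic_superderivation_form\<close> will produce its symplectic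
  structure.\<close>

sublocale quadratic_double_extension \<subseteq> E: quadratic_lie_superalgebra ext_scale ext_G ext_br ext_B
  by (rule quadratic_lie_superalgebra_ext)

section \<open>The extended superderivation\<close>

locale filiform_double_extension =
  quadratic_double_extension scale G br B D + filiform_lie_superalgebra scale G br +
  finite_dimensional_vector_space scale Basis
  for scale :: "'k::field \<Rightarrow> 'v::ab_group_add \<Rightarrow> 'v" and G :: "bit \<Rightarrow> 'v set"
    and br :: "'v \<Rightarrow> 'v \<Rightarrow> 'v" and B :: "'v \<Rightarrow> 'v \<Rightarrow> 'k" and D :: "'v \<Rightarrow> 'v"
    and Basis :: "'v set" +
  fixes \<delta> :: "'v \<Rightarrow> 'v" and \<alpha> :: 'k and A0 :: 'v
  assumes \<delta>_superderivation: "even_superderivation scale G br \<delta>"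
    and \<delta>_skew: "skew_supersymmetric_endo B \<delta>"
    and \<alpha>_nonzero: "\<alpha> \<noteq> 0"
    and A0_even: "A0 \<in> G 0"
    and commutator: "\<delta> (D X) - D (\<delta> X) + scale \<alpha> (D X) = br A0 X"
begin

lemma \<delta>_linear: "Vector_Spaces.linear scale scale \<delta>"
  and \<delta>_even: "X \<in> G x \<Longrightarrow> \<delta> X \<in> G x"
  and \<delta>_br: "\<delta> (br X Y) = br (\<delta> X) Y + br X (\<delta> Y)"
  using \<delta>_superderivation by (auto simp: even_superderivation_def)

lemma \<delta>_simps [simp]:
  "\<delta> (X + Y) = \<delta> X + \<delta> Y" "\<delta> (X - Y) = \<delta> X - \<delta> Y" "\<delta> (- X) = - \<delta> X"
  "\<delta> (scale k X) = scale k (\<delta> X)" "\<delta> 0 = 0"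
  using \<delta>_linear unfolding Vector_Spaces.linear_iff_module_hom
  by (simp_all add: module_hom.add module_hom.diff module_hom.neg module_hom.scale module_hom.zero)

lemma B_\<delta>: "B (\<delta> X) Y = - B X (\<delta> Y)"
  using \<delta>_skew by (simp add: skew_supersymmetric_endo_def)

abbreviation "ext_\<delta> \<equiv> dext_endo scale B \<delta> \<alpha> A0"

text \<open>On a pair of \<open>e\<close> and an embedded vector, the middle component of the
  Leibniz rule is exactly the commutator relation. The \<open>e*\<close>-components are settled by
  \<open>DA0\<close> for such pairs and by \<open>D\<delta>\<close> for two embedded
  vectors.\<close>

lemma even_superderivation_ext_\<delta>: "even_superderivation ext_scale ext_G ext_br ext_\<delta>"
  unfolding even_superderivation_def linear_ext_iff[OF vector_space_ext]
proof (intro conjI allI ballI)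
  fix u v :: "('k, 'v) dext" and k
  show "ext_\<delta> (u + v) = ext_\<delta> u + ext_\<delta> v"
    by (auto simp: dext_endo_def scale_left_distrib algebra_simps split: prod.split)
  show "ext_\<delta> (ext_scale k u) = ext_scale k (ext_\<delta> u)"
    by (cases u) (simp add: dext_endo_def dext_scale_def scale_right_distrib algebra_simps)
  obtain a X c b Y d where uv: "u = (a, X, c)" "v = (b, Y, d)" by (metis prod_cases3)
  have comm: "\<delta> (D X) = D (\<delta> X) - scale \<alpha> (D X) + br A0 X" for X
    using commutator[of X] by (simp add: algebra_simps)
  have skewA0: "br X A0 = - br A0 X"
  proof -
    obtain X0 X1 where X: "X0 \<in> G 0" "X1 \<in> G 1" "X = X0 + X1" using G_sum by blast
    show ?thesis
      using skew_br[OF X(1) A0_even] skew_br[OF X(2) A0_even] by (simp add: X(3))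
  qed
  have DA0: "B (D A0) Y = - B (D Y) A0"
    by (simp only: B_D[of A0 Y] B_commute_even[OF A0_even])
  \<comment> \<open>Skewness of \<delta> creates \<delta> after \<open>D\<close>, the commutator
    relation swaps the two, and invariance moves the bracket with \<open>A0\<close> onto
    \<open>X\<close> and \<open>Y\<close>.\<close>
  have "B (D X) (\<delta> Y) = - B (D (\<delta> X)) Y + \<alpha> * B (D X) Y - B A0 (br X Y)"
    using B_\<delta>[of "D X" Y] by (simp add: comm invariant_B algebra_simps)
  then have D\<delta>: "B (D X) (\<delta> Y) = - B (D (\<delta> X)) Y + \<alpha> * B (D X) Y - B (br X Y) A0"
    using B_commute_even[OF A0_even] by simp
  show "ext_\<delta> (ext_br u v) = ext_br (ext_\<delta> u) v + ext_br u (ext_\<delta> v)"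
    by (simp add: uv dext_endo_def dext_bracket_def comm \<delta>_br skewA0 DA0 D\<delta>
        scale_right_distrib scale_right_diff_distrib algebra_simps)
next
  fix x u assume "u \<in> ext_G x"
  then show "ext_\<delta> u \<in> ext_G x"
    using bit_cases[of x] A0_even
    by (auto simp: dext_grading_def dext_endo_def \<delta>_even B_even_odd
        subspace_add[OF subspace_G] subspace_scale[OF subspace_G])
qed

lemma skew_ext_\<delta>: "skew_supersymmetric_endo ext_B ext_\<delta>"
  using B_commute_even[OF A0_even]
  by (auto simp: skew_supersymmetric_endo_def dext_form_def dext_endo_def B_\<delta> algebra_simps)

lemma bij_ext_\<delta>:
  assumes "bij \<delta>"
  shows "bij ext_\<delta>"
proof (rule bij_betw_byWitness)
  \<comment> \<open>The endomorphism is triangular with diagonal entries -\<alpha>, \<delta>,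
    \<alpha>; \<open>g\<close> solves for the three components in that order.\<close>
  define g where "g = (\<lambda>(b, Y, d). let a = - (b / \<alpha>); X = inv \<delta> (Y - scale a A0)
    in (a, X, (d + B X A0) / \<alpha>))"
  show "\<forall>u\<in>UNIV. g (ext_\<delta> u) = u"
    using assms \<alpha>_nonzero by (auto simp: g_def dext_endo_def Let_def bij_is_inj)
  show "\<forall>u\<in>UNIV. ext_\<delta> (g u) = u"
    using assms \<alpha>_nonzero by (auto simp: g_def dext_endo_def Let_def bij_is_surj surj_f_inv_f)
qed auto

section \<open>Filiform type of the double extension\<close>

text \<open>Both \<delta> and \<open>D\<close> preserve \<open>V (Suc i)\<close> and
  \<open>V i\<close>, so they act by scalars on the one-dimensional quotient and commute there. The
  bracket with \<open>A0\<close> maps \<open>V (Suc i)\<close> into \<open>V i\<close>, so \<alpha>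
  times \<open>D\<close> acts as zero on the quotient, and \<alpha> can be divided out.\<close>

lemma D_lowers_flag:
  fixes V :: "nat \<Rightarrow> 'v set"
  assumes top: "V m = G 1"
    and sub: "\<forall>i\<le>m. subspace (V i) \<and> dim (V i) = i"
    and mono: "\<forall>i<m. V i \<subset> V (Suc i)"
    and step: "\<forall>i<m. span {br X Y |X Y. X \<in> G 0 \<and> Y \<in> V (Suc i)} = V i"
    and i: "i < m" and X: "X \<in> V (Suc i)"
  shows "D X \<in> V i"
proof -
  have Vi: "subspace (V i)" "dim (V i) = i" and VS: "subspace (V (Suc i))" "dim (V (Suc i)) = Suc i"
    using sub i by auto
  note invariant = superderivation_flag_invariant[OF _ top step]
  have br_in: "br A0 Y \<in> V i" if "Y \<in> V (Suc i)" for Y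
    using step i that A0_even by (auto intro!: span_base)
  show ?thesis
  proof (cases "X \<in> V i")
    case True
    then show ?thesis using invariant[OF D_superderivation] i by auto
  next
    case False
    \<comment> \<open>By dimension count, a vector outside \<open>V i\<close> spans
      \<open>V (Suc i)\<close> together with \<open>V i\<close>.\<close>
    have "dim (insert X (V i)) = Suc i"
      using dim_insert[of X "V i"] False Vi by (simp add: span_eq_iff[THEN iffD2])
    moreover have "span (insert X (V i)) \<subseteq> V (Suc i)"
      using mono i X VS by (intro span_minimal) auto
    ultimately have V_eq: "V (Suc i) = span (insert X (V i))"
      using subspace_dim_equal[of "span (insert X (V i))" "V (Suc i)"] VS by simp
    have decomp: "\<exists>k Z. Z \<in> V i \<and> Y = scale k X + Z" if "Y \<in> V (Suc i)" for Y
      using that Vi unfolding V_eq span_breakdown_eq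
      by (metis add.commute diff_add_cancel span_eq_iff)
    obtain k W where DX: "D X = scale k X + W" and W: "W \<in> V i"
      using decomp invariant[OF D_superderivation _ X] i by (metis Suc_leI)
    obtain l W' where \<delta>X: "\<delta> X = scale l X + W'" and W': "W' \<in> V i"
      using decomp invariant[OF \<delta>_superderivation _ X] i by (metis Suc_leI)
    \<comment> \<open>The two multiples of \<open>X\<close>, with coefficients \<open>k * l\<close>
      and \<open>l * k\<close>, cancel; what remains lies in \<open>V i\<close>.\<close>
    have "\<delta> (D X) - D (\<delta> X) = scale k W' + \<delta> W - scale l W - D W'"
      by (simp add: DX \<delta>X scale_right_distrib algebra_simps)
    also have "\<dots> \<in> V i"
      using W W' Vi invariant[OF D_superderivation] invariant[OF \<delta>_superderivation] i
      by (intro subspace_diff subspace_add subspace_scale) auto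
    finally have "br A0 X - (\<delta> (D X) - D (\<delta> X)) \<in> V i"
      by (rule subspace_diff[OF Vi(1) br_in[OF X]])
    then have "scale \<alpha> (D X) \<in> V i"
      using commutator[of X] by (metis add_diff_cancel_left')
    then have "scale (inverse \<alpha>) (scale \<alpha> (D X)) \<in> V i"
      using Vi subspace_scale by blast
    then show ?thesis using \<alpha>_nonzero by simp
  qed
qed

text \<open>The odd part is a copy of \<open>G 1\<close>, so the embedded flag is the candidate.
  Among the new even elements \<open>e*\<close> acts by zero and \<open>e\<close> acts as
  \<open>D\<close>, which already lowers the flag.\<close>

lemma filiform_ext: "filiform_lie_superalgebra ext_scale ext_G ext_br"
proof -
  interpret P: finite_dimensional_vector_space_pair_1 scale Basis ext_scale
    by unfold_locales
  have lin: "Vector_Spaces.linear scale ext_scale dext_emb"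
    by (auto simp: Vector_Spaces.linear_iff dext_scale_def vector_space_ext vector_space_axioms)
  have dim: "E.dim (dext_emb ` S) = dim S" for S :: "'v set"
    using P.dim_image_eq[OF lin] by (auto simp: inj_on_def)
  have span: "E.span (dext_emb ` S) = dext_emb ` span S" for S :: "'v set"
    using P.linear_span_image[OF lin] by simp
  have G1: "ext_G 1 = dext_emb ` G 1"
    by (auto simp: dext_grading_def)
  define m where "m = dim (G 1)"
  obtain V :: "nat \<Rightarrow> 'v set" where top: "V m = G 1"
    and sub: "\<forall>i\<le>m. subspace (V i) \<and> dim (V i) = i"
    and mono: "\<forall>i<m. V i \<subset> V (Suc i)"
    and step: "\<forall>i<m. span {br X Y |X Y. X \<in> G 0 \<and> Y \<in> V (Suc i)} = V i"
    using filiform_flag unfolding m_def by auto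
  \<comment> \<open>Oddness of the flag makes the term \<open>B (D X) Y\<close> vanish for even
    \<open>X\<close>, so brackets with the embedded flag have no
    \<open>e*\<close>-component.\<close>
  have V_odd: "V i \<subseteq> G 1" if "i \<le> m" for i
    using that
  proof (induction rule: inc_induct)
    case base then show ?case using top by simp
  next
    case (step i) then show ?case using mono by blast
  qed
  have E_step: "E.span {ext_br u v |u v. u \<in> ext_G 0 \<and> v \<in> dext_emb ` V (Suc i)} = dext_emb ` V i"
    if i: "i < m" for i
  proof -
    let ?S = "{br X Y |X Y. X \<in> G 0 \<and> Y \<in> V (Suc i)}"
    \<comment> \<open>\<open>?T\<close> collects the brackets with arbitrary even elements of the
      extension. It contains \<open>?S\<close> (take \<open>a = 0\<close>) and lies in
      \<open>V i\<close> because \<open>D\<close> lowers the flag, so its span is squeezed to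
      \<open>V i\<close>.\<close>
    let ?T = "{scale a (D Y) + br X Y |a X Y. X \<in> G 0 \<and> Y \<in> V (Suc i)}"
    have br: "ext_br (a, X, c) (dext_emb Y) = dext_emb (scale a (D Y) + br X Y)"
      if "X \<in> G 0" "Y \<in> V (Suc i)" for a X c Y
      using that V_odd[of "Suc i"] i B_even_odd(1)[OF D_even] by (auto simp: dext_bracket_def)
    have "{ext_br u v |u v. u \<in> ext_G 0 \<and> v \<in> dext_emb ` V (Suc i)} = dext_emb ` ?T"
      by (force simp: br dext_grading_def image_iff)
    moreover have "?S \<subseteq> ?T"
    proof clarify
      fix X Y assume "X \<in> G 0" "Y \<in> V (Suc i)"
      then show "\<exists>a X' Y'. br X Y = scale a (D Y') + br X' Y' \<and> X' \<in> G 0 \<and> Y' \<in> V (Suc i)"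
        by (intro exI[of _ 0] exI[of _ X] exI[of _ Y]) simp
    qed
    then have "span ?S \<subseteq> span ?T"
      by (rule span_mono)
    moreover have "span ?S = V i"
      using step i by blast
    moreover have "?T \<subseteq> V i"
    proof clarify
      fix a X Y assume "X \<in> G 0" "Y \<in> V (Suc i)"
      then have "br X Y \<in> span ?S"
        by (blast intro: span_base)
      then show "scale a (D Y) + br X Y \<in> V i"
        using D_lowers_flag[OF top sub mono step i \<open>Y \<in> V (Suc i)\<close>] sub i step
        by (simp add: subspace_add subspace_scale)
    qed
    then have "span ?T \<subseteq> V i"
      using sub i by (intro span_minimal) auto
    ultimately show ?thesis
      by (simp add: span)
  qed
  show ?thesis
  proof unfold_locales
    show "E.dim (ext_G 1) > 0"
      using odd_dim_pos by (simp add: G1 dim)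
    have "E.subspace (dext_emb ` V i)" if "i \<le> m" for i
      using that sub P.linear_subspace_image[OF lin] by blast
    moreover have "(dext_emb ` V i :: ('k, 'v) dext set) \<subset> dext_emb ` V (Suc i)" if "i < m" for i
      using mono that by (intro image_strict_mono) (auto simp: inj_on_def)
    ultimately show "\<exists>V. V (E.dim (ext_G 1)) = ext_G 1 \<and>
      (\<forall>i\<le>E.dim (ext_G 1). E.subspace (V i) \<and> E.dim (V i) = i) \<and>
      (\<forall>i<E.dim (ext_G 1). V i \<subset> V (Suc i)) \<and>
      (\<forall>i<E.dim (ext_G 1). E.span {ext_br X Y |X Y. X \<in> ext_G 0 \<and> Y \<in> V (Suc i)} = V i)"
      using top sub E_step
      by (intro exI[of _ "\<lambda>i. dext_emb ` V i"]) (simp add: G1 dim m_def[symmetric])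
  qed
qed

end

theorem proposition5p1:
  fixes scale :: "'k::field_char_0 \<Rightarrow> 'v::ab_group_add \<Rightarrow> 'v"
    and G :: "bit \<Rightarrow> 'v set"
    and br :: "'v \<Rightarrow> 'v \<Rightarrow> 'v"
    and B \<omega> :: "'v \<Rightarrow> 'v \<Rightarrow> 'k"
    and \<delta> D :: "'v \<Rightarrow> 'v"
    and \<alpha> :: 'k and A0 :: 'v
  assumes quadratic_symplectic: "quadratic_symplectic_lie_superalgebra scale G br B \<omega>"
    and finite_dimensional: "\<exists>Basis. finite_dimensional_vector_space scale Basis"
    and filiform: "filiform_lie_superalgebra scale G br"
    and \<delta>_superderivation: "even_superderivation scale G br \<delta>"
    and \<delta>_invertible: "bij \<delta>"
    and \<delta>_skew: "skew_supersymmetric_endo B \<delta>"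
    and \<omega>_\<delta>: "\<And>X Y. \<omega> X Y = B (\<delta> X) Y"
    and D_superderivation: "even_superderivation scale G br D"
    and D_skew: "skew_supersymmetric_endo B D"
    and \<alpha>_nonzero: "\<alpha> \<noteq> 0"
    and A0_even: "A0 \<in> G 0"
    and commutator: "\<And>X. \<delta> (D X) - D (\<delta> X) + scale \<alpha> (D X) = br A0 X"
  defines "scale' \<equiv> dext_scale scale"
    and "G' \<equiv> dext_grading G"
    and "br' \<equiv> dext_bracket scale br B D"
    and "B' \<equiv> dext_form B"
    and "\<delta>' \<equiv> dext_endo scale B \<delta> \<alpha> A0"
  defines "\<omega>' \<equiv> (\<lambda>X Y. B' (\<delta>' X) Y)"
  shows "even_superderivation scale' G' br' \<delta>' \<and> bij \<delta>' \<and> skew_supersymmetric_endo B' \<delta>' \<and>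
    quadratic_symplectic_lie_superalgebra scale' G' br' B' \<omega>' \<and>
    filiform_lie_superalgebra scale' G' br'"
proof -
  interpret quadratic_symplectic_lie_superalgebra scale G br B \<omega>
    by (rule quadratic_symplectic)
  interpret filiform_lie_superalgebra scale G br
    by (rule filiform)
  obtain Basis where "finite_dimensional_vector_space scale Basis"
    using finite_dimensional by blast
  then interpret finite_dimensional_vector_space scale Basis .
  interpret filiform_double_extension scale G br B D Basis \<delta> \<alpha> A0
    using D_superderivation D_skew \<delta>_superderivation \<delta>_skew \<alpha>_nonzero A0_even commutator
    by (unfold_locales) auto
  \<comment> \<open>The general construction of a symplectic form from a bijective skew
    superderivation, applied inside the extension.\<close>
  have "symplectic_lie_superalgebra scale' G' br' \<omega>'"
    unfolding \<omega>'_def B'_def \<delta>'_def scale'_def G'_def br'_def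
    by (rule E.symplectic_superderivation_form[OF even_superderivation_ext_\<delta> skew_ext_\<delta>
          bij_ext_\<delta>[OF \<delta>_invertible]])
  then have "quadratic_symplectic_lie_superalgebra scale' G' br' B' \<omega>'"
    using quadratic_lie_superalgebra_ext
    unfolding B'_def scale'_def G'_def br'_def
    by (intro quadratic_symplectic_lie_superalgebra.intro)
  with even_superderivation_ext_\<delta> bij_ext_\<delta>[OF \<delta>_invertible] skew_ext_\<delta> filiform_ext
  show ?thesis
    unfolding B'_def \<delta>'_def scale'_def G'_def br'_def by (intro conjI)
qed

end
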